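(* Let $M,N$ be typable terms of the simply typed $\lambda$-calculus such that $M\to_\beta N$. Then $\mathcal{W}(M)>\mathcal{W}(N)$, where $\mathcal{W}(M)\in\mathbb{N}_0$ is the number of wrappers in the full simplification $\mathtt{S}_*(M)$ of $M$ (regarded as a $\lambda^{\mathbf m}$-term).
   Context: Simple types: $A::=\alpha\mid A\to B$ with $\alpha$ ranging over base types. Terms of the simply typed $\lambda$-calculus (STLC, Church style, up to $\alpha$-renaming): $M::=x^A\mid\lambda x^A.M\mid M\,N$, with usual typing; $\to_\beta$ is the closure under contexts of $(\lambda x.M)\,N\to_\beta M[x:=N]$. $\lambda^{\mathbf m}$-terms: $t,s::=x^A\mid\lambda x^A.t\mid t\,s\mid t\{s\}$ (up to $\alpha$-renaming). A term $t\{s\}$ is called a wrapper. Typing: the usual STLC rules plus: $\Gamma\vdash t:A$ and $\Gamma\vdash s:B$ imply $\Gamma\vdash t\{s\}:A$. Typable terms have a unique type. Every $\lambda$-term is also a $\lambda^{\mathbf m}$-term (without wrappers). Memories: $L::=\Box\mid L\{t\}$; if $L=\Box\{s_1\}\dots\{s_n\}$, then $tL$ denotes $t\{s_1\}\dots\{s_n\}$. An $\mathbf m$-abstraction is a term $(\lambda x.t)L$ (possibly $L=\Box$); its degree is the height of its type, where $\mathsf h(\alpha)=0$ and $\mathsf h(A\to B)=1+\max(\mathsf h(A),\mathsf h(B))$. A redex is a term $(\lambda x.t)L\,s$; its degree is the degree of $(\lambda x.t)L$. $\mathsf{maxdeg}(t)$ is the maximum degree of the redexes occurring in $t$, or $0$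 if there are none. For $d\ge1$, the simplification of degree $d$ is defined by: $\mathtt S_d(x)=x$; $\mathtt S_d(\lambda x.t)=\lambda x.\mathtt S_d(t)$; $\mathtt S_d(t\,s)=\mathtt S_d(t')[x:=\mathtt S_d(s)]\{\mathtt S_d(s)\}\mathtt S_d(L)$ if $t=(\lambda x.t')L$ is of degree $d$, and $\mathtt S_d(t\,s)=\mathtt S_d(t)\,\mathtt S_d(s)$ otherwise; $\mathtt S_d(t\{s\})=\mathtt S_d(t)\{\mathtt S_d(s)\}$; on memories, $\mathtt S_d(\Box)=\Box$ and $\mathtt S_d(L\{t\})=\mathtt S_d(L)\{\mathtt S_d(t)\}$. Full simplification: $\mathtt S_*(t)=\mathtt S_1(\mathtt S_2(\dots\mathtt S_D(t)))$ where $D=\mathsf{maxdeg}(t)$. The weight $\mathsf w(t)$ is the number of wrappers (occurrences of subterms of the form $s\{u\}$) in $t$. For a typable $\lambda$-term $M$, $\mathcal W(M)=\mathsf w(\mathtt S_*(M))$. *)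

theory Defs
  imports Main
begin

text \<open>
  Terms up to renaming of bound variables are represented with de Bruijn indices.
  In the Church style every variable occurrence carries its type; an occurrence is
  well typed only if this annotation agrees with the context (in particular, with
  the annotation of its binder).
\<close>

datatype 'b ty = Base 'b | Fun "'b ty" "'b ty"  (infixr "\<rightarrow>" 200)

primrec height :: "'b ty \<Rightarrow> nat" where
  "height (Base \<alpha>) = 0"
| "height (A \<rightarrow> B) = 1 + max (height A) (height B)"

section \<open>The simply typed lambda-calculus\<close>

datatype 'b lam = LVar nat "'b ty" | LLam "'b ty" "'b lam" | LApp "'b lam" "'b lam"

inductive lam_typing :: "'b ty list \<Rightarrow> 'b lam \<Rightarrow> 'b ty \<Rightarrow> bool"
  ("_ \<turnstile>\<^sub>\<lambda> _ : _" [50, 50, 50] 50) where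
  "i < length \<Gamma> \<Longrightarrow> \<Gamma> ! i = A \<Longrightarrow> \<Gamma> \<turnstile>\<^sub>\<lambda> LVar i A : A"
| "A # \<Gamma> \<turnstile>\<^sub>\<lambda> M : B \<Longrightarrow> \<Gamma> \<turnstile>\<^sub>\<lambda> LLam A M : A \<rightarrow> B"
| "\<Gamma> \<turnstile>\<^sub>\<lambda> M : A \<rightarrow> B \<Longrightarrow> \<Gamma> \<turnstile>\<^sub>\<lambda> N : A \<Longrightarrow> \<Gamma> \<turnstile>\<^sub>\<lambda> LApp M N : B"

definition lam_typable :: "'b lam \<Rightarrow> bool" where
  "lam_typable M \<longleftrightarrow> (\<exists>\<Gamma> A. \<Gamma> \<turnstile>\<^sub>\<lambda> M : A)"

primrec lam_lift :: "nat \<Rightarrow> 'b lam \<Rightarrow> 'b lam" where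
  "lam_lift k (LVar i A) = LVar (if i < k then i else Suc i) A"
| "lam_lift k (LLam A M) = LLam A (lam_lift (Suc k) M)"
| "lam_lift k (LApp M N) = LApp (lam_lift k M) (lam_lift k N)"

text \<open>
  \<open>lam_subst k N M\<close> replaces the variable with index \<open>k\<close> in \<open>M\<close> by \<open>N\<close> and decrements
  the indices above \<open>k\<close>, the binder of \<open>k\<close> having been removed.
\<close>

primrec lam_subst :: "nat \<Rightarrow> 'b lam \<Rightarrow> 'b lam \<Rightarrow> 'b lam" where
  "lam_subst k N (LVar i A) =
     (if i < k then LVar i A else if i = k then N else LVar (i - 1) A)"
| "lam_subst k N (LLam A M) = LLam A (lam_subst (Suc k) (lam_lift 0 N) M)"
| "lam_subst k N (LApp M M') = LApp (lam_subst k N M) (lam_subst k N M')"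

inductive beta :: "'b lam \<Rightarrow> 'b lam \<Rightarrow> bool"  (infix "\<rightarrow>\<^sub>\<beta>" 50) where
  "LApp (LLam A M) N \<rightarrow>\<^sub>\<beta> lam_subst 0 N M"
| "M \<rightarrow>\<^sub>\<beta> M' \<Longrightarrow> LLam A M \<rightarrow>\<^sub>\<beta> LLam A M'"
| "M \<rightarrow>\<^sub>\<beta> M' \<Longrightarrow> LApp M N \<rightarrow>\<^sub>\<beta> LApp M' N"
| "N \<rightarrow>\<^sub>\<beta> N' \<Longrightarrow> LApp M N \<rightarrow>\<^sub>\<beta> LApp M N'"

section \<open>Terms with wrappers\<close>

datatype 'b mterm =
    Var nat "'b ty" | Lam "'b ty" "'b mterm" | App "'b mterm" "'b mterm"
  | Wrap "'b mterm" "'b mterm"  ("_\<lbrace>_\<rbrace>" [900, 0] 900)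

primrec mterm_of :: "'b lam \<Rightarrow> 'b mterm" where
  "mterm_of (LVar i A) = Var i A"
| "mterm_of (LLam A M) = Lam A (mterm_of M)"
| "mterm_of (LApp M N) = App (mterm_of M) (mterm_of N)"

inductive typing :: "'b ty list \<Rightarrow> 'b mterm \<Rightarrow> 'b ty \<Rightarrow> bool"
  ("_ \<turnstile> _ : _" [50, 50, 50] 50) where
  "i < length \<Gamma> \<Longrightarrow> \<Gamma> ! i = A \<Longrightarrow> \<Gamma> \<turnstile> Var i A : A"
| "A # \<Gamma> \<turnstile> t : B \<Longrightarrow> \<Gamma> \<turnstile> Lam A t : A \<rightarrow> B"
| "\<Gamma> \<turnstile> t : A \<rightarrow> B \<Longrightarrow> \<Gamma> \<turnstile> s : A \<Longrightarrow> \<Gamma> \<turnstile> App t s : B"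
| "\<Gamma> \<turnstile> t : A \<Longrightarrow> \<Gamma> \<turnstile> s : B \<Longrightarrow> \<Gamma> \<turnstile> t\<lbrace>s\<rbrace> : A"

text \<open>
  Because variables are annotated, the type of a typable term can be read off the
  term alone; the value on untypable terms is irrelevant.
\<close>

primrec type_of :: "'b mterm \<Rightarrow> 'b ty" where
  "type_of (Var i A) = A"
| "type_of (Lam A t) = A \<rightarrow> type_of t"
| "type_of (App t s) = (case type_of t of A \<rightarrow> B \<Rightarrow> B | Base \<alpha> \<Rightarrow> Base \<alpha>)"
| "type_of (t\<lbrace>s\<rbrace>) = type_of t"

lemma typing_type_of: "\<Gamma> \<turnstile> t : A \<Longrightarrow> type_of t = A"
  by (induction rule: typing.induct) simp_all

lemma typing_unique: "\<Gamma> \<turnstile> t : A \<Longrightarrow> \<Delta> \<turnstile> t : B \<Longrightarrow> A = B"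
  using typing_type_of by blast

lemma typing_mterm_of: "\<Gamma> \<turnstile>\<^sub>\<lambda> M : A \<Longrightarrow> \<Gamma> \<turnstile> mterm_of M : A"
  by (induction rule: lam_typing.induct) (auto intro: typing.intros)

primrec lift :: "nat \<Rightarrow> 'b mterm \<Rightarrow> 'b mterm" where
  "lift k (Var i A) = Var (if i < k then i else Suc i) A"
| "lift k (Lam A t) = Lam A (lift (Suc k) t)"
| "lift k (App t s) = App (lift k t) (lift k s)"
| "lift k (t\<lbrace>s\<rbrace>) = (lift k t)\<lbrace>lift k s\<rbrace>"

primrec subst :: "nat \<Rightarrow> 'b mterm \<Rightarrow> 'b mterm \<Rightarrow> 'b mterm" where
  "subst k u (Var i A) =
     (if i < k then Var i A else if i = k then u else Var (i - 1) A)"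
| "subst k u (Lam A t) = Lam A (subst (Suc k) (lift 0 u) t)"
| "subst k u (App t s) = App (subst k u t) (subst k u s)"
| "subst k u (t\<lbrace>s\<rbrace>) = (subst k u t)\<lbrace>subst k u s\<rbrace>"

text \<open>
  A memory \<open>\<box>{s\<^sub>1}\<dots>{s\<^sub>n}\<close> is represented by the list \<open>[s\<^sub>1, \<dots>, s\<^sub>n]\<close>, and \<open>wraps t L\<close>
  is \<open>tL\<close>. Every term is uniquely of the form \<open>tL\<close> with \<open>t\<close> not a wrapper; \<open>core\<close>
  and \<open>memory\<close> yield this \<open>t\<close> and \<open>L\<close>.
\<close>

definition wraps :: "'b mterm \<Rightarrow> 'b mterm list \<Rightarrow> 'b mterm" where
  "wraps t L = foldl Wrap t L"

fun core :: "'b mterm \<Rightarrow> 'b mterm" where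
  "core (t\<lbrace>s\<rbrace>) = core t"
| "core t = t"

fun memory :: "'b mterm \<Rightarrow> 'b mterm list" where
  "memory (t\<lbrace>s\<rbrace>) = memory t @ [s]"
| "memory t = []"

lemma wraps_core_memory: "wraps (core t) (memory t) = t"
  by (induction t) (simp_all add: wraps_def)

lemma core_wraps: "core (wraps t L) = core t"
  by (induction L rule: rev_induct) (simp_all add: wraps_def)

lemma memory_wraps: "memory (wraps t L) = memory t @ L"
  by (induction L rule: rev_induct) (simp_all add: wraps_def)

lemma size_core: "size (core t) \<le> size t"
  by (induction t) simp_all

lemma size_memory: "u \<in> set (memory t) \<Longrightarrow> size u < size t"
  by (induction t) auto

definition m_abstraction :: "'b mterm \<Rightarrow> bool" where
  "m_abstraction t \<longleftrightarrow> (\<exists>A t' L. t = wraps (Lam A t') L)"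

definition degree :: "'b mterm \<Rightarrow> nat" where
  "degree t = height (type_of t)"

primrec subterms :: "'b mterm \<Rightarrow> 'b mterm set" where
  "subterms (Var i A) = {Var i A}"
| "subterms (Lam A t) = insert (Lam A t) (subterms t)"
| "subterms (App t s) = insert (App t s) (subterms t \<union> subterms s)"
| "subterms (t\<lbrace>s\<rbrace>) = insert (t\<lbrace>s\<rbrace>) (subterms t \<union> subterms s)"

lemma finite_subterms: "finite (subterms t)"
  by (induction t) simp_all

definition redex_degrees :: "'b mterm \<Rightarrow> nat set" where
  "redex_degrees u = {degree t |t s. App t s \<in> subterms u \<and> m_abstraction t}"

lemma finite_redex_degrees: "finite (redex_degrees u)"
proof -
  have "redex_degrees u \<subseteq> (\<lambda>r. case r of App t s \<Rightarrow> degree t | _ \<Rightarrow> 0) ` subterms u"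
    by (force simp: redex_degrees_def)
  then show ?thesis
    using finite_subterms finite_surj by blast
qed

definition maxdeg :: "'b mterm \<Rightarrow> nat" where
  "maxdeg t = Max (insert 0 (redex_degrees t))"

section \<open>Simplification\<close>

function simplify :: "nat \<Rightarrow> 'b mterm \<Rightarrow> 'b mterm" where
  "simplify d (Var i A) = Var i A"
| "simplify d (Lam A t) = Lam A (simplify d t)"
| "simplify d (App t s) =
     (case core t of
        Lam A t' \<Rightarrow>
          if degree t = d
          then wraps ((subst 0 (simplify d s) (simplify d t'))\<lbrace>simplify d s\<rbrace>)
                 (map (simplify d) (memory t))
          else App (simplify d t) (simplify d s)
      | _ \<Rightarrow> App (simplify d t) (simplify d s))"
| "simplify d (t\<lbrace>s\<rbrace>) = (simplify d t)\<lbrace>simplify d s\<rbrace>"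
  by pat_completeness auto
termination
proof (relation "measure (\<lambda>(d, t). size t)")
  fix d s A and t t' :: "'b mterm"
  assume "core t = Lam A t'"
  then show "((d, t'), d, App t s) \<in> measure (\<lambda>(d, t). size t)"
    using size_core[of t] by simp
qed (auto dest: size_memory)

lemma simplify_redex:
  assumes "t = wraps (Lam A t') L" and "degree t = d"
  shows "simplify d (App t s) =
    wraps ((subst 0 (simplify d s) (simplify d t'))\<lbrace>simplify d s\<rbrace>) (map (simplify d) L)"
  using assms by (simp add: core_wraps memory_wraps)

lemma simplify_non_redex:
  assumes "\<not> (m_abstraction t \<and> degree t = d)"
  shows "simplify d (App t s) = App (simplify d t) (simplify d s)"
proof (cases "core t")
  case (Lam A t')
  then have "t = wraps (Lam A t') (memory t)"
    using wraps_core_memory[of t] by simp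
  then have "m_abstraction t"
    unfolding m_abstraction_def by blast
  then show ?thesis
    using assms Lam by simp
qed simp_all

text \<open>\<open>simplify_upto n t\<close> is \<open>S\<^sub>1(S\<^sub>2(\<dots>S\<^sub>n(t)))\<close>.\<close>

primrec simplify_upto :: "nat \<Rightarrow> 'b mterm \<Rightarrow> 'b mterm" where
  "simplify_upto 0 t = t"
| "simplify_upto (Suc n) t = simplify_upto n (simplify (Suc n) t)"

definition full_simplify :: "'b mterm \<Rightarrow> 'b mterm" where
  "full_simplify t = simplify_upto (maxdeg t) t"

primrec weight :: "'b mterm \<Rightarrow> nat" where
  "weight (Var i A) = 0"
| "weight (Lam A t) = weight t"
| "weight (App t s) = weight t + weight s"
| "weight (t\<lbrace>s\<rbrace>) = 1 + weight t + weight s"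

definition W_measure :: "'b lam \<Rightarrow> nat" where
  "W_measure M = weight (full_simplify (mterm_of M))"

end

theory Submission imports Defs "HOL-Library.Confluence"
begin

text \<open>
  Contracting a redex in the wrapper calculus records its argument in a wrapper, so a
  \<open>\<beta>\<close>-step \<open>M \<rightarrow>\<^sub>\<beta> N\<close> factors as a contraction \<open>M \<Rightarrow> t\<close> followed by erasing the single
  wrapper just created. Contraction is confluent and full simplification computes normal
  forms, so \<open>M\<close> and \<open>t\<close> have the same full simplification. Simplification never discards the
  argument of a redex, hence erasing wrappers commutes with it, strictly: if \<open>s\<close> arises
  from \<open>t\<close> by erasing at least one wrapper, then its full simplification arises from that of
  \<open>t\<close> in the same way.
\<close>

section \<open>Contraction of redexes\<close>

fun is_abs :: "'b mterm \<Rightarrow> bool" where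
  "is_abs (Lam A t) = True"
| "is_abs (t\<lbrace>u\<rbrace>) = is_abs t"
| "is_abs _ = False"

text \<open>On \<open>(\<lambda>x.t)L\<close> and \<open>s\<close> this yields \<open>t[x:=s]{s}L\<close>.\<close>

fun contract :: "'b mterm \<Rightarrow> 'b mterm \<Rightarrow> 'b mterm" where
  "contract (Lam A t) s = (subst 0 s t)\<lbrace>s\<rbrace>"
| "contract (t\<lbrace>u\<rbrace>) s = (contract t s)\<lbrace>u\<rbrace>"
| "contract t s = App t s"

lemma is_abs_iff_core: "is_abs t \<longleftrightarrow> (\<exists>A t'. core t = Lam A t')"
  by (induction t) auto

lemma is_abs_iff_m_abstraction: "is_abs t \<longleftrightarrow> m_abstraction t"
  unfolding is_abs_iff_core m_abstraction_def
  by (metis core.simps(3) core_wraps wraps_core_memory)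

lemma contract_simplify:
  "core t = Lam A t' \<Longrightarrow> contract (simplify d t) u =
     wraps ((subst 0 u (simplify d t'))\<lbrace>u\<rbrace>) (map (simplify d) (memory t))"
  by (induction t) (simp_all add: wraps_def)

text \<open>
  The defining equation recurses into \<^term>\<open>core t\<close> and \<^term>\<open>memory t\<close>; with this one,
  structural induction suffices.
\<close>

lemma simplify_App:
  "simplify d (App t s) =
     (if is_abs t \<and> degree t = d then contract (simplify d t) (simplify d s)
      else App (simplify d t) (simplify d s))"
proof (cases "is_abs t")
  case True
  then obtain A t' where "core t = Lam A t'"
    by (auto simp: is_abs_iff_core)
  then show ?thesis
    using True by (simp add: contract_simplify)
next
  case False
  then show ?thesis
    by (subst simplify_non_redex) (auto simp: is_abs_iff_m_abstraction)
qed

declare simplify.simps(3) [simp del] simplify_App [simp]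

section \<open>Lifting and substitution\<close>

lemma lift_lift: "i \<le> k \<Longrightarrow> lift (Suc k) (lift i t) = lift i (lift k t)"
  by (induction t arbitrary: i k) auto

lemma lift_subst_ge:
  "k \<le> j \<Longrightarrow> lift j (subst k u t) = subst k (lift j u) (lift (Suc j) t)"
  by (induction t arbitrary: j k u) (auto simp: lift_lift)

lemma lift_subst_le:
  "j \<le> k \<Longrightarrow> lift j (subst k u t) = subst (Suc k) (lift j u) (lift j t)"
  by (induction t arbitrary: j k u) (auto simp: lift_lift)

lemma subst_lift: "subst k u (lift k t) = t"
  by (induction t arbitrary: k u) auto

lemma subst_subst:
  "i \<le> k \<Longrightarrow> subst k u (subst i v t) = subst i (subst k u v) (subst (Suc k) (lift i u) t)"
  by (induction t arbitrary: i k u v)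
    (auto simp: subst_lift lift_lift lift_subst_le)

lemma is_abs_lift [simp]: "is_abs (lift k t) = is_abs t"
  by (induction t) auto

lemma is_abs_subst: "is_abs t \<Longrightarrow> is_abs (subst k u t)"
  by (induction t) auto

lemma lift_contract: "lift k (contract t s) = contract (lift k t) (lift k s)"
  by (induction t) (auto simp: lift_subst_ge)

text \<open>If the core of \<open>t\<close> is a variable, substitution can turn \<open>t\<close>
  into an abstraction, so that \<open>contract\<close> acts after substituting but not before; the
  hypothesis excludes this.\<close>

lemma subst_contract:
  "is_abs t \<Longrightarrow> subst k u (contract t s) = contract (subst k u t) (subst k u s)"
  by (induction t) (auto simp: subst_subst)

lemma typing_lift:
  "\<Gamma> @ \<Delta> \<turnstile> t : A \<Longrightarrow> \<Gamma> @ B # \<Delta> \<turnstile> lift (length \<Gamma>) t : A"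
proof (induction "\<Gamma> @ \<Delta>" t A arbitrary: \<Gamma> rule: typing.induct)
  case (1 i A)
  then show ?case
    by (auto intro!: typing.intros simp: nth_append Suc_diff_le)
next
  case (2 C t A)
  from 2(2)[of "C # \<Gamma>"] show ?case
    by (auto intro: typing.intros)
qed (auto intro: typing.intros)

lemma typing_subst:
  "\<Gamma> @ B # \<Delta> \<turnstile> t : A \<Longrightarrow> \<Gamma> @ \<Delta> \<turnstile> u : B \<Longrightarrow> \<Gamma> @ \<Delta> \<turnstile> subst (length \<Gamma>) u t : A"
proof (induction "\<Gamma> @ B # \<Delta>" t A arbitrary: \<Gamma> u rule: typing.induct)
  case (1 i A)
  then show ?case
    by (auto intro!: typing.intros simp: nth_append nth_Cons' split: if_splits)
next
  case (2 C t A)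
  have "C # \<Gamma> @ \<Delta> \<turnstile> lift 0 u : B"
    using typing_lift[of "[]"] 2(3) by fastforce
  then show ?case
    using 2(2)[of "C # \<Gamma>"] by (auto intro: typing.intros)
qed (auto intro: typing.intros)

inductive_cases typing_VarE: "\<Gamma> \<turnstile> Var i A : B"
inductive_cases typing_LamE: "\<Gamma> \<turnstile> Lam A t : B"
inductive_cases typing_AppE: "\<Gamma> \<turnstile> App t s : B"
inductive_cases typing_WrapE: "\<Gamma> \<turnstile> t\<lbrace>s\<rbrace> : B"

lemmas typing_elims = typing_VarE typing_LamE typing_AppE typing_WrapE

lemma typing_contract:
  "\<Gamma> \<turnstile> t : A \<rightarrow> B \<Longrightarrow> \<Gamma> \<turnstile> s : A \<Longrightarrow> \<Gamma> \<turnstile> contract t s : B"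
proof (induction t)
  case (Lam C t)
  then show ?case
    using typing_subst[of "[]"] by (auto elim!: typing_elims intro!: typing.intros)
qed (auto elim!: typing_elims intro: typing.intros)

section \<open>Parallel contraction\<close>

text \<open>Parallel reduction in the style of Tait and Martin-Loef: any choice of the redexes
  present, of whatever degrees, is contracted at once.\<close>

inductive par :: "'b mterm \<Rightarrow> 'b mterm \<Rightarrow> bool"  (infix "\<Rrightarrow>" 50) where
  par_Var: "Var i A \<Rrightarrow> Var i A"
| par_Lam: "t \<Rrightarrow> t' \<Longrightarrow> Lam A t \<Rrightarrow> Lam A t'"
| par_App: "t \<Rrightarrow> t' \<Longrightarrow> s \<Rrightarrow> s' \<Longrightarrow> App t s \<Rrightarrow> App t' s'"
| par_Wrap: "t \<Rrightarrow> t' \<Longrightarrow> s \<Rrightarrow> s' \<Longrightarrow> t\<lbrace>s\<rbrace> \<Rrightarrow> t'\<lbrace>s'\<rbrace>"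
| par_contract: "is_abs t \<Longrightarrow> t \<Rrightarrow> t' \<Longrightarrow> s \<Rrightarrow> s' \<Longrightarrow> App t s \<Rrightarrow> contract t' s'"

inductive_cases par_LamE: "Lam A t \<Rrightarrow> r"
inductive_cases par_WrapE: "t\<lbrace>s\<rbrace> \<Rrightarrow> r"

lemma par_refl: "t \<Rrightarrow> t"
  by (induction t) (auto intro: par.intros)

lemma par_is_abs: "t \<Rrightarrow> t' \<Longrightarrow> is_abs t \<Longrightarrow> is_abs t'"
  by (induction rule: par.induct) auto

lemma par_lift: "t \<Rrightarrow> t' \<Longrightarrow> lift k t \<Rrightarrow> lift k t'"
  by (induction arbitrary: k rule: par.induct) (auto intro: par.intros simp: lift_contract)

lemma par_subst: "t \<Rrightarrow> t' \<Longrightarrow> u \<Rrightarrow> u' \<Longrightarrow> subst k u t \<Rrightarrow> subst k u' t'"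
proof (induction arbitrary: k u u' rule: par.induct)
  case (par_contract t t' s s')
  then show ?case
    by (auto intro!: par.par_contract simp: subst_contract is_abs_subst par_is_abs)
next
  case (par_Lam t t' A)
  then show ?case
    by (simp add: par.par_Lam par_lift)
qed (auto intro!: par_Var par_App par_Wrap)

lemma par_contract_cong:
  "is_abs t \<Longrightarrow> t \<Rrightarrow> t' \<Longrightarrow> s \<Rrightarrow> s' \<Longrightarrow> contract t s \<Rrightarrow> contract t' s'"
  by (induction t arbitrary: t')
    (auto elim!: par_LamE par_WrapE intro!: par_Wrap par_subst)

primrec complete_development :: "'b mterm \<Rightarrow> 'b mterm" where
  "complete_development (Var i A) = Var i A"
| "complete_development (Lam A t) = Lam A (complete_development t)"
| "complete_development (App t s) =
     (if is_abs t then contract (complete_development t) (complete_development s)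
      else App (complete_development t) (complete_development s))"
| "complete_development (t\<lbrace>s\<rbrace>) = (complete_development t)\<lbrace>complete_development s\<rbrace>"

text \<open>Takahashi's triangle property: contracting the redexes left over by a parallel step
  leads to the complete development.\<close>

lemma par_complete_development: "t \<Rrightarrow> t' \<Longrightarrow> t' \<Rrightarrow> complete_development t"
  by (induction rule: par.induct)
    (auto intro: par.intros par_contract_cong simp: par_is_abs)

text \<open>The complete development of a term is one parallel step away from each of its reducts,
  so it closes every peak.\<close>

lemma confluentp_par: "confluentp ((\<Rrightarrow>) :: 'b mterm \<Rightarrow> 'b mterm \<Rightarrow> bool)"
  by (rule strong_confluentp_imp_confluentp, rule strong_confluentpI)
    (blast intro: par_complete_development)

lemma par_typing: "t \<Rrightarrow> t' \<Longrightarrow> \<Gamma> \<turnstile> t : A \<Longrightarrow> \<Gamma> \<turnstile> t' : A"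
  by (induction arbitrary: \<Gamma> A rule: par.induct)
    (auto elim!: typing_elims intro: typing.intros, (blast intro: typing.intros typing_contract)+)

text \<open>Simplification contracts the redexes of degree \<open>d\<close> present at the start,
  all together, so it inherits what holds for parallel steps.\<close>

lemma par_simplify: "t \<Rrightarrow> simplify d t"
  by (induction t) (auto intro: par.intros)

lemma simplify_typing: "\<Gamma> \<turnstile> t : A \<Longrightarrow> \<Gamma> \<turnstile> simplify d t : A"
  by (rule par_typing[OF par_simplify])

section \<open>Degrees of redexes under simplification\<close>

text \<open>A structural form of the bound \<open>maxdeg t \<le> n\<close>, suited to induction on
  terms.\<close>

primrec maxdeg_le :: "nat \<Rightarrow> 'b mterm \<Rightarrow> bool" where
  "maxdeg_le n (Var i A) = True"
| "maxdeg_le n (Lam A t) = maxdeg_le n t"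
| "maxdeg_le n (App t s) =
     (maxdeg_le n t \<and> maxdeg_le n s \<and> (is_abs t \<longrightarrow> degree t \<le> n))"
| "maxdeg_le n (t\<lbrace>s\<rbrace>) = (maxdeg_le n t \<and> maxdeg_le n s)"

lemma redex_degrees_simps [simp]:
  "redex_degrees (Var i A) = {}"
  "redex_degrees (Lam A t) = redex_degrees t"
  "redex_degrees (App t s) =
     redex_degrees t \<union> redex_degrees s \<union> (if is_abs t then {degree t} else {})"
  "redex_degrees (t\<lbrace>s\<rbrace>) = redex_degrees t \<union> redex_degrees s"
  by (auto simp: redex_degrees_def is_abs_iff_m_abstraction)

lemma maxdeg_le_iff_redex_degrees: "maxdeg_le n t \<longleftrightarrow> (\<forall>m\<in>redex_degrees t. m \<le> n)"
  by (induction t) auto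

lemma maxdeg_le_iff: "maxdeg_le n t \<longleftrightarrow> maxdeg t \<le> n"
  by (simp add: maxdeg_le_iff_redex_degrees maxdeg_def finite_redex_degrees)

lemma type_of_lift [simp]: "type_of (lift k t) = type_of t"
  by (induction t arbitrary: k) (auto split: ty.splits)

lemma maxdeg_le_lift [simp]: "maxdeg_le n (lift k t) = maxdeg_le n t"
  by (induction t arbitrary: k) (auto simp: degree_def)

text \<open>Substitution makes an abstraction out of a non-abstraction only by replacing a variable
  at the core, and then \<open>t\<close> has the type of that variable.\<close>

lemma is_abs_subst_cases:
  "is_abs (subst (length \<Gamma>) u t) \<Longrightarrow> \<Gamma> @ B # \<Delta> \<turnstile> t : A \<Longrightarrow> is_abs t \<or> A = B"
  by (induction t) (auto elim!: typing_elims split: if_splits)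

text \<open>By \<open>is_abs_subst_cases\<close>, redexes created by the substitution have degree
  \<open>height B\<close>; all others keep theirs, since types are preserved.\<close>

lemma maxdeg_le_subst:
  assumes "maxdeg_le n t" and "maxdeg_le n u" and "height B \<le> n"
    and "\<Gamma> @ B # \<Delta> \<turnstile> t : A" and "\<Gamma> @ \<Delta> \<turnstile> u : B"
  shows "maxdeg_le n (subst (length \<Gamma>) u t)"
  using assms
proof (induction t arbitrary: \<Gamma> u A)
  case (Lam C t)
  have "C # \<Gamma> @ \<Delta> \<turnstile> lift 0 u : B"
    using typing_lift[of "[]"] Lam.prems(5) by fastforce
  then show ?case
    using Lam.IH[of "lift 0 u" "C # \<Gamma>"] Lam.prems by (auto elim!: typing_elims)
next
  case (App t s)
  from App.prems(4) obtain C where t: "\<Gamma> @ B # \<Delta> \<turnstile> t : C \<rightarrow> A" and s: "\<Gamma> @ B # \<Delta> \<turnstile> s : C"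
    by (auto elim: typing_elims)
  have "\<Gamma> @ \<Delta> \<turnstile> subst (length \<Gamma>) u t : C \<rightarrow> A"
    by (rule typing_subst[OF t App.prems(5)])
  then have "degree (subst (length \<Gamma>) u t) = height (C \<rightarrow> A)" "degree t = height (C \<rightarrow> A)"
    using t by (simp_all add: degree_def typing_type_of)
  then show ?case
    using App.IH(1)[OF _ _ _ t] App.IH(2)[OF _ _ _ s] App.prems is_abs_subst_cases[OF _ t]
    by fastforce
qed (auto elim!: typing_elims)

text \<open>Redexes created at the bound variable have degree \<open>height A\<close>, strictly
  below the degree of the contracted redex.\<close>

lemma maxdeg_le_contract:
  "is_abs t \<Longrightarrow> maxdeg_le n t \<Longrightarrow> maxdeg_le n s \<Longrightarrow> height A \<le> n \<Longrightarrow>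
    \<Gamma> \<turnstile> t : A \<rightarrow> B \<Longrightarrow> \<Gamma> \<turnstile> s : A \<Longrightarrow> maxdeg_le n (contract t s)"
  by (induction t) (auto elim!: typing_elims intro: maxdeg_le_subst[where \<Gamma> = "[]", simplified])

text \<open>A contractum may itself be an abstraction, but its type is the codomain of an arrow type
  of height \<open>d\<close>, hence of smaller height.\<close>

lemma is_abs_simplify_cases:
  "is_abs (simplify d t) \<Longrightarrow> \<Gamma> \<turnstile> t : A \<Longrightarrow> is_abs t \<or> height A < d"
proof (induction t)
  case (App t s)
  then obtain C where "\<Gamma> \<turnstile> t : C \<rightarrow> A"
    by (auto elim: typing_elims)
  then have "degree t = height (C \<rightarrow> A)"
    by (simp add: degree_def typing_type_of)
  then show ?case
    using App.prems(1) by (auto split: if_splits)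
qed (auto elim!: typing_elims)

text \<open>All redexes of top degree are contracted at once; new ones arise from the substituted
  argument or from a contractum in function position, and both kinds have lower degree.\<close>

lemma maxdeg_le_simplify:
  "maxdeg_le (Suc n) t \<Longrightarrow> \<Gamma> \<turnstile> t : A \<Longrightarrow> maxdeg_le n (simplify (Suc n) t)"
proof (induction t arbitrary: \<Gamma> A)
  case (App t s)
  from App.prems(2) obtain C where t: "\<Gamma> \<turnstile> t : C \<rightarrow> A" and s: "\<Gamma> \<turnstile> s : C"
    by (auto elim: typing_elims)
  note ts = simplify_typing[OF t, of "Suc n"] and ss = simplify_typing[OF s, of "Suc n"]
  have IH: "maxdeg_le n (simplify (Suc n) t)" "maxdeg_le n (simplify (Suc n) s)"
    using App t s by auto
  have deg: "degree t = height (C \<rightarrow> A)" "degree (simplify (Suc n) t) = height (C \<rightarrow> A)"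
    using t ts by (simp_all add: degree_def typing_type_of)
  show ?case
  proof (cases "is_abs t \<and> degree t = Suc n")
    case True
    then have "maxdeg_le n (contract (simplify (Suc n) t) (simplify (Suc n) s))"
      using deg by (intro maxdeg_le_contract[OF _ IH _ ts ss] par_is_abs[OF par_simplify]) auto
    then show ?thesis
      using True by simp
  next
    case False
    \<comment> \<open>Either \<open>t\<close> is an abstraction of degree other than
      \<open>Suc n\<close>, hence at most \<open>n\<close>, or simplification has made it one, and
      then its type has height below \<open>Suc n\<close>.\<close>
    then show ?thesis
      using IH deg App.prems(1) is_abs_simplify_cases[OF _ t, of "Suc n"] by auto
  qed
qed (auto elim!: typing_elims)

lemma simplify_id: "maxdeg_le n t \<Longrightarrow> simplify (Suc n) t = t"
  by (induction t) auto

section \<open>Full simplification computes normal forms\<close>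

lemma par_simplify_upto: "(\<Rrightarrow>)\<^sup>*\<^sup>* t (simplify_upto n t)"
proof (induction n arbitrary: t)
  case (Suc n)
  show ?case
    using converse_rtranclp_into_rtranclp[OF par_simplify Suc.IH] by simp
qed simp

lemma simplify_upto_typing: "\<Gamma> \<turnstile> t : A \<Longrightarrow> \<Gamma> \<turnstile> simplify_upto n t : A"
  by (induction n arbitrary: t) (auto intro: simplify_typing)

lemma maxdeg_le_simplify_upto:
  "maxdeg_le n t \<Longrightarrow> \<Gamma> \<turnstile> t : A \<Longrightarrow> maxdeg_le 0 (simplify_upto n t)"
  by (induction n arbitrary: t) (auto intro: maxdeg_le_simplify simplify_typing)

lemma simplify_upto_eq:
  "maxdeg_le m t \<Longrightarrow> m \<le> n \<Longrightarrow> simplify_upto n t = simplify_upto m t"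
proof (induction n)
  case (Suc n)
  show ?case
  proof (cases "m = Suc n")
    case False
    then have "maxdeg_le n t"
      using Suc.prems by (auto simp: maxdeg_le_iff)
    then show ?thesis
      using Suc False by (simp add: simplify_id)
  qed simp
qed simp

text \<open>Simplification at degrees above \<open>maxdeg t\<close> is the identity, so any upper
  bound can serve as the starting degree.\<close>

lemma full_simplify_eq: "maxdeg t \<le> n \<Longrightarrow> full_simplify t = simplify_upto n t"
  using simplify_upto_eq[of "maxdeg t" t n] by (simp add: full_simplify_def maxdeg_le_iff)

text \<open>An m-abstraction has an arrow type and so degree at least 1; in a typable term the bound
  0 therefore leaves no redex.\<close>

lemma par_normal: "t \<Rrightarrow> t' \<Longrightarrow> maxdeg_le 0 t \<Longrightarrow> \<Gamma> \<turnstile> t : A \<Longrightarrow> t' = t"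
  by (induction arbitrary: \<Gamma> A rule: par.induct)
    (auto elim!: typing_elims dest: typing_type_of simp: degree_def)

lemma pars_normal: "(\<Rrightarrow>)\<^sup>*\<^sup>* t t' \<Longrightarrow> maxdeg_le 0 t \<Longrightarrow> \<Gamma> \<turnstile> t : A \<Longrightarrow> t' = t"
  by (induction rule: rtranclp_induct) (auto dest: par_normal)

lemma full_simplify_par:
  assumes "t \<Rrightarrow> t'" and "\<Gamma> \<turnstile> t : A"
  shows "full_simplify t = full_simplify t'"
proof -
  have t': "\<Gamma> \<turnstile> t' : A"
    using assms by (rule par_typing)
  have nf: "maxdeg_le 0 (full_simplify s)" "\<Gamma> \<turnstile> full_simplify s : A" if "\<Gamma> \<turnstile> s : A" for s
    using that maxdeg_le_iff[of "maxdeg s" s] unfolding full_simplify_def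
    by (auto intro: maxdeg_le_simplify_upto simplify_upto_typing)
  have reach: "(\<Rrightarrow>)\<^sup>*\<^sup>* s (full_simplify s)" for s :: "'a mterm"
    by (simp add: full_simplify_def par_simplify_upto)
  have "(\<Rrightarrow>)\<^sup>*\<^sup>* t (full_simplify t')"
    using assms(1) reach by (rule converse_rtranclp_into_rtranclp)
  \<comment> \<open>Both full simplifications are reachable from \<open>t\<close>; being normal,
    each must equal the common reduct \<open>r\<close>.\<close>
  from confluentpD[OF confluentp_par reach this] obtain r
    where "(\<Rrightarrow>)\<^sup>*\<^sup>* (full_simplify t) r" and "(\<Rrightarrow>)\<^sup>*\<^sup>* (full_simplify t') r"
    by blast
  then show ?thesis
    using nf[OF assms(2)] nf[OF t'] pars_normal by metis
qed

section \<open>Erasing wrappers\<close>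

text \<open>Any number of wrappers may be dropped, possibly none; strictness is tracked separately,
  by comparing weights.\<close>

inductive erases :: "'b mterm \<Rightarrow> 'b mterm \<Rightarrow> bool"  (infix "\<unrhd>" 50) where
  erases_Var: "Var i A \<unrhd> Var i A"
| erases_Lam: "t \<unrhd> t' \<Longrightarrow> Lam A t \<unrhd> Lam A t'"
| erases_App: "t \<unrhd> t' \<Longrightarrow> s \<unrhd> s' \<Longrightarrow> App t s \<unrhd> App t' s'"
| erases_Wrap: "t \<unrhd> t' \<Longrightarrow> s \<unrhd> s' \<Longrightarrow> t\<lbrace>s\<rbrace> \<unrhd> t'\<lbrace>s'\<rbrace>"
| erases_drop: "t \<unrhd> t' \<Longrightarrow> t\<lbrace>s\<rbrace> \<unrhd> t'"

lemma erases_refl: "t \<unrhd> t"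
  by (induction t) (auto intro: erases.intros)

text \<open>Together with \<open>erases_type_of\<close>, this makes \<open>simplify d\<close> take
  the same branch at corresponding applications.\<close>

lemma erases_is_abs: "t \<unrhd> t' \<Longrightarrow> is_abs t' = is_abs t"
  by (induction rule: erases.induct) auto

lemma erases_type_of: "t \<unrhd> t' \<Longrightarrow> type_of t' = type_of t"
  by (induction rule: erases.induct) auto

lemma erases_lift: "t \<unrhd> t' \<Longrightarrow> lift k t \<unrhd> lift k t'"
  by (induction arbitrary: k rule: erases.induct) (auto intro: erases.intros)

lemma erases_subst: "t \<unrhd> t' \<Longrightarrow> u \<unrhd> u' \<Longrightarrow> subst k u t \<unrhd> subst k u' t'"
proof (induction arbitrary: k u u' rule: erases.induct)
  case (erases_Lam t t' A)
  then show ?case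
    by (simp add: erases.erases_Lam erases_lift)
qed (auto intro: erases.intros)

lemma erases_weight: "t \<unrhd> t' \<Longrightarrow> weight t' \<le> weight t"
  by (induction rule: erases.induct) auto

lemma weight_lift [simp]: "weight (lift k t) = weight t"
  by (induction t arbitrary: k) auto

lemma weight_subst_ge: "weight t \<le> weight (subst k u t)"
  by (induction t arbitrary: k u) (auto intro: add_mono)

text \<open>
  Substitution adds to the weight of \<open>t\<close> that of \<open>u\<close> once per occurrence of the variable;
  the inequality compares these increments, stated without subtraction.
\<close>

lemma erases_weight_subst:
  "t \<unrhd> t' \<Longrightarrow> u \<unrhd> u' \<Longrightarrow>
    weight (subst k u' t') + weight t \<le> weight (subst k u t) + weight t'"
proof (induction arbitrary: k u u' rule: erases.induct)
  case (erases_Lam t t' A)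
  then show ?case
    using erases_lift by fastforce
next
  case (erases_App t t' s s')
  from erases_App.IH[OF erases_App.prems, of k] show ?case by simp
next
  case (erases_Wrap t t' s s')
  from erases_Wrap.IH[OF erases_Wrap.prems, of k] show ?case by simp
next
  case (erases_drop t t' s)
  from erases_drop.IH[OF erases_drop.prems, of k] weight_subst_ge[of s k u] show ?case by simp
qed (auto dest: erases_weight)

lemma erases_contract:
  "t \<unrhd> t' \<Longrightarrow> is_abs t \<Longrightarrow> s \<unrhd> s' \<Longrightarrow> contract t s \<unrhd> contract t' s'"
  by (induction rule: erases.induct) (auto intro: erases.intros erases_subst)

text \<open>Contraction does not narrow the difference in weight: \<open>erases_weight_subst\<close>
  covers the bodies, and the new wrapper keeps the argument even if the bound variable does not
  occur.\<close>

lemma erases_weight_contract: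
  "t \<unrhd> t' \<Longrightarrow> is_abs t \<Longrightarrow> s \<unrhd> s' \<Longrightarrow>
    weight (contract t' s') + weight t + weight s \<le> weight (contract t s) + weight t' + weight s'"
proof (induction rule: erases.induct)
  case (erases_Lam t t' A)
  then show ?case
    using erases_weight_subst[of t t' s s' 0] by simp
qed (auto dest: erases_weight)

lemma erases_simplify: "t \<unrhd> t' \<Longrightarrow> simplify d t \<unrhd> simplify d t'"
  by (induction rule: erases.induct)
    (auto intro: erases.intros erases_contract
      simp: erases_is_abs erases_type_of degree_def par_is_abs[OF par_simplify])

text \<open>Some component is strictly lighter while the others are no heavier, and contraction
  preserves the resulting gap.\<close>

lemma erases_weight_simplify:
  "t \<unrhd> t' \<Longrightarrow> weight t' < weight t \<Longrightarrow> weight (simplify d t') < weight (simplify d t)"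
proof (induction rule: erases.induct)
  case (erases_App t t' s s')
  have le: "weight t' \<le> weight t" "weight s' \<le> weight s"
    "weight (simplify d t') \<le> weight (simplify d t)"
    "weight (simplify d s') \<le> weight (simplify d s)"
    using erases_App.hyps by (auto intro: erases_weight erases_simplify)
  have less: "weight (simplify d t') + weight (simplify d s')
      < weight (simplify d t) + weight (simplify d s)"
    using erases_App.IH erases_App.prems le by fastforce
  have contract: "weight (contract (simplify d t') (simplify d s'))
      < weight (contract (simplify d t) (simplify d s))" if "is_abs t"
    using erases_weight_contract[of "simplify d t" "simplify d t'" "simplify d s" "simplify d s'"]
      erases_App.hyps that less by (simp add: erases_simplify par_is_abs[OF par_simplify])
  show ?case
    using less contract erases_App.hyps(1)
    by (simp add: erases_is_abs erases_type_of degree_def)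
next
  case (erases_Wrap t t' s s')
  have le: "weight t' \<le> weight t" "weight s' \<le> weight s"
    "weight (simplify d t') \<le> weight (simplify d t)"
    "weight (simplify d s') \<le> weight (simplify d s)"
    using erases_Wrap.hyps by (auto intro: erases_weight erases_simplify)
  then show ?case
    using erases_Wrap.IH erases_Wrap.prems by fastforce
next
  case (erases_drop t t' s)
  \<comment> \<open>The dropped wrapper survives simplification on the heavier side and alone gives
    strictness, so a weak inequality suffices here.\<close>
  have "weight (simplify d t') \<le> weight (simplify d t)"
    using erases_drop.hyps by (intro erases_weight erases_simplify)
  then show ?case by simp
qed auto

lemma erases_weight_simplify_upto:
  "t \<unrhd> t' \<Longrightarrow> weight t' < weight t \<Longrightarrow>
    weight (simplify_upto n t') < weight (simplify_upto n t)"
  by (induction n arbitrary: t t') (auto intro: erases_simplify erases_weight_simplify)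

lemma erases_weight_full_simplify:
  assumes "t \<unrhd> t'" and "weight t' < weight t"
  shows "weight (full_simplify t') < weight (full_simplify t)"
  \<comment> \<open>Redexes inside erased wrappers disappear, so the maximal degrees may differ;
    starting at their maximum sends both terms through the same simplifications.\<close>
  using erases_weight_simplify_upto[OF assms, of "max (maxdeg t) (maxdeg t')"]
  by (simp add: full_simplify_eq[of _ "max (maxdeg t) (maxdeg t')"])

section \<open>Beta-steps\<close>

lemma mterm_of_lift: "mterm_of (lam_lift k M) = lift k (mterm_of M)"
  by (induction M arbitrary: k) auto

lemma mterm_of_subst: "mterm_of (lam_subst k N M) = subst k (mterm_of N) (mterm_of M)"
  by (induction M arbitrary: k N) (auto simp: mterm_of_lift)

text \<open>At the root, dropping the wrapper around the contractum leaves the ordinary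
  substitution; contexts carry over because both relations are congruences.\<close>

lemma beta_par_erases:
  "M \<rightarrow>\<^sub>\<beta> N \<Longrightarrow> \<exists>t. mterm_of M \<Rrightarrow> t \<and> t \<unrhd> mterm_of N \<and> weight (mterm_of N) < weight t"
proof (induction rule: beta.induct)
  case (1 A M N)
  let ?u = "subst 0 (mterm_of N) (mterm_of M)"
  have "App (Lam A (mterm_of M)) (mterm_of N) \<Rrightarrow> contract (Lam A (mterm_of M)) (mterm_of N)"
    by (intro par.par_contract par_refl) simp
  then have "mterm_of (LApp (LLam A M) N) \<Rrightarrow> ?u\<lbrace>mterm_of N\<rbrace>"
    by simp
  moreover have "?u\<lbrace>mterm_of N\<rbrace> \<unrhd> ?u"
    by (intro erases_drop erases_refl)
  ultimately show ?case
    by (intro exI[of _ "?u\<lbrace>mterm_of N\<rbrace>"]) (simp add: mterm_of_subst)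
next
  case (2 M M' A)
  then obtain t where "mterm_of M \<Rrightarrow> t" "t \<unrhd> mterm_of M'" "weight (mterm_of M') < weight t"
    by blast
  then show ?case
    by (intro exI[of _ "Lam A t"]) (auto intro: par_Lam erases_Lam)
next
  case (3 M M' N)
  then obtain t where "mterm_of M \<Rrightarrow> t" "t \<unrhd> mterm_of M'" "weight (mterm_of M') < weight t"
    by blast
  then show ?case
    by (intro exI[of _ "App t (mterm_of N)"]) (auto intro: par_App erases_App par_refl erases_refl)
next
  case (4 N N' M)
  then obtain t where "mterm_of N \<Rrightarrow> t" "t \<unrhd> mterm_of N'" "weight (mterm_of N') < weight t"
    by blast
  then show ?case
    by (intro exI[of _ "App (mterm_of M) t"]) (auto intro: par_App erases_App par_refl erases_refl)
qed

theorem theorem15: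
  fixes M N :: "'b lam"
  assumes "lam_typable M" and "lam_typable N" and "M \<rightarrow>\<^sub>\<beta> N"
  shows "W_measure M > W_measure N"
proof -
  obtain t where t: "mterm_of M \<Rrightarrow> t" "t \<unrhd> mterm_of N" "weight (mterm_of N) < weight t"
    using beta_par_erases[OF assms(3)] by blast
  obtain \<Gamma> A where "\<Gamma> \<turnstile> mterm_of M : A"
    using assms(1) typing_mterm_of unfolding lam_typable_def by blast
  then have "full_simplify (mterm_of M) = full_simplify t"
    by (rule full_simplify_par[OF t(1)])
  then show ?thesis
    using erases_weight_full_simplify[OF t(2,3)] by (simp add: W_measure_def)
qed

end
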